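(* Suppose there exists $h \in \mathcal{H}(\theta)$ such that $$T(x) := F(x) + H(x) \geq 0 \quad \text{for all } x \in \Omega,$$ where $H(x)$ is the symmetric matrix associated with $h$ as defined in the context. Then $$\int_\Omega \bar f(x, v_\theta(u(x)))\,dx = \int_\Omega v_\theta(u(x))^{T} F(x)\, v_\theta(u(x))\,dx \geq 0$$ for every $u \in \mathcal{U}$.
   Context: Let $\Omega=[0,1]$, let $n\ge 1$ and $\theta \ge 1$ be integers. For $u=(u_1,\dots,u_n)\in \mathcal{C}^{\theta}(\Omega;\mathbb{R}^n)$ and an integer $0\le s\le\theta$, $v_s(u)$ denotes the vector of all $u_j$ and all their derivatives $\partial_x^i u_j$ up to order $s$, i.e. $v_s(u) = (\partial_x^i u_j)_{1\le j\le n,\ 0\le i\le s}\in\mathbb{R}^{n(s+1)}$, a function of $x$. Boundary conditions: fix a real matrix $B$ with $n_b$ rows and $2n\theta$ columns. Let $\mathcal{U}$ be the set of $u\in \mathcal{C}^{\theta}(\Omega;\mathbb{R}^n)$ with $$B\begin{bmatrix} v_{\theta-1}(u)(1)\\ v_{\theta-1}(u)(0)\end{bmatrix}=0 .$$ Let $F:\Omega\to\mathbb{R}^{n(\theta+1)\times n(\theta+1)}$ be continuous with symmetric values, and put $\bar f(x,v)=v^{T}F(x)v$. Let $v_{s}^{\{2\}}(u)$ be the vector of all monomials of degree $2$ in the entries of $v_{s}(u)$, and let $n_r$ be the length of $v_{\theta-1}^{\{2\}}(u)$. Let $C$ be the constant matrix with $\frac{\partial}{\partial x} v_{\theta-1}^{\{2\}}(u)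 = C\, v_\theta^{\{2\}}(u)$ (identity obtained by the product rule). With $\odot$ the elementwise product, $\preceq$ elementwise inequality, and $g|_{\partial\Omega}:=g(1)-g(0)$, define $$\mathcal{H}(\theta) := \left\{ h\in \mathcal{C}^1(\Omega;\mathbb{R}^{n_r}) : \big(h\odot v_{\theta-1}^{\{2\}}(u)\big)\big|_{\partial\Omega}\preceq 0 \ \text{ for all } u\in\mathcal{U}\right\}.$$ For $h\in\mathcal{H}(\theta)$ put $$\bar h(x,v_\theta(u)) := h_x(x)\odot v_{\theta-1}^{\{2\}}(u) + h(x)\odot C\,v_\theta^{\{2\}}(u)\in\mathbb{R}^{n_r}.$$ The sum of its entries is a quadratic form in the entries of $v_\theta$ (regarded as independent variables); $H(x)$ denotes the symmetric matrix with $\sum_{i=1}^{n_r}\bar h_i(x,v_\theta) = v_\theta^{T}H(x)v_\theta$. For a symmetric matrix $A$, $A\ge 0$ means positive semidefinite. *)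

theory Defs
  imports "HOL-Analysis.Analysis" "Jordan_Normal_Form.Matrix"
begin

(* From here on "$" and the bullet are those of variable-dimension vectors. *)
unbundle no vec_syntax and no inner_syntax

abbreviation Omega :: "real set" (\<open>\<Omega>\<close>) where
  "\<Omega> \<equiv> {0..1}"

(* Derivative on the closed interval: one-sided at the endpoints 0 and 1. *)
definition d_Omega :: "(real \<Rightarrow> real) \<Rightarrow> real \<Rightarrow> real" (\<open>\<partial>\<^sub>x\<close>) where
  "\<partial>\<^sub>x f x = vector_derivative f (at x within \<Omega>)"

definition d_Omega_vec :: "(real \<Rightarrow> real vec) \<Rightarrow> real \<Rightarrow> real vec" where
  "d_Omega_vec g x = vec (dim_vec (g x)) (\<lambda>i. \<partial>\<^sub>x (\<lambda>y. g y $ i) x)"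

definition C_fun :: "nat \<Rightarrow> nat \<Rightarrow> (real \<Rightarrow> real vec) set" where
  "C_fun k m = {g. (\<forall>x\<in>\<Omega>. g x \<in> carrier_vec m) \<and>
     (\<forall>j<m. (\<forall>i<k. (\<partial>\<^sub>x ^^ i) (\<lambda>y. g y $ j) differentiable_on \<Omega>) \<and>
            (\<forall>i\<le>k. continuous_on \<Omega> ((\<partial>\<^sub>x ^^ i) (\<lambda>y. g y $ j))))}"

(* v_s(u)(x), listed by order of differentiation: entry i * n + j is the i-th derivative of u_j,
   with components and entries counted from 0. Hence v_(s-1) consists of the first n * s
   entries of v_s. *)
definition jet :: "nat \<Rightarrow> nat \<Rightarrow> (real \<Rightarrow> real vec) \<Rightarrow> real \<Rightarrow> real vec" where
  "jet n s u x = vec (n * (s + 1)) (\<lambda>k. (\<partial>\<^sub>x ^^ (k div n)) (\<lambda>y. u y $ (k mod n)) x)"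

definition U_set :: "nat \<Rightarrow> nat \<Rightarrow> nat \<Rightarrow> real mat \<Rightarrow> (real \<Rightarrow> real vec) set" where
  "U_set n \<theta> nb B = {u \<in> C_fun \<theta> n.
     B *\<^sub>v (jet n (\<theta> - 1) u 1 @\<^sub>v jet n (\<theta> - 1) u 0) = 0\<^sub>v nb}"

definition fbar :: "(real \<Rightarrow> real mat) \<Rightarrow> real \<Rightarrow> real vec \<Rightarrow> real" where
  "fbar F x v = v \<bullet> (F x *\<^sub>v v)"

definition pairs :: "nat \<Rightarrow> (nat \<times> nat) list" where
  "pairs N = [(a, b). a \<leftarrow> [0..<N], b \<leftarrow> [a..<N]]"

(* Every monomial of degree 2 occurs exactly once, as w_a * w_b with a <= b. *)
definition mono2 :: "real vec \<Rightarrow> real vec" where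
  "mono2 w = vec_of_list (map (\<lambda>(a, b). w $ a * w $ b) (pairs (dim_vec w)))"

definition n_mono :: "nat \<Rightarrow> nat" where
  "n_mono N = length (pairs N)"

definition hadamard :: "real vec \<Rightarrow> real vec \<Rightarrow> real vec" (infixl \<open>\<odot>\<^sub>v\<close> 75) where
  "v \<odot>\<^sub>v w = vec (dim_vec v) (\<lambda>i. v $ i * w $ i)"

definition is_C_mat :: "nat \<Rightarrow> nat \<Rightarrow> real mat \<Rightarrow> bool" where
  "is_C_mat n \<theta> C \<longleftrightarrow>
     C \<in> carrier_mat (n_mono (n * \<theta>)) (n_mono (n * (\<theta> + 1))) \<and>
     (\<forall>u\<in>C_fun \<theta> n. \<forall>x\<in>\<Omega>.
        d_Omega_vec (\<lambda>y. mono2 (jet n (\<theta> - 1) u y)) x = C *\<^sub>v mono2 (jet n \<theta> u x))"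

(* Existence and uniqueness for n, \<theta> >= 1: lemma C_mat_ex1 below. *)
definition C_mat :: "nat \<Rightarrow> nat \<Rightarrow> real mat" where
  "C_mat n \<theta> = (THE C. is_C_mat n \<theta> C)"

definition H_set :: "nat \<Rightarrow> nat \<Rightarrow> nat \<Rightarrow> real mat \<Rightarrow> (real \<Rightarrow> real vec) set" where
  "H_set n \<theta> nb B = {h \<in> C_fun 1 (n_mono (n * \<theta>)).
     \<forall>u\<in>U_set n \<theta> nb B.
       h 1 \<odot>\<^sub>v mono2 (jet n (\<theta> - 1) u 1) - h 0 \<odot>\<^sub>v mono2 (jet n (\<theta> - 1) u 0)
         \<le> 0\<^sub>v (n_mono (n * \<theta>))}"

(* v stands for v_\<theta> as a tuple of independent variables; its first n * \<theta> entries are those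
   of v_(\<theta>-1). *)
definition hbar :: "nat \<Rightarrow> nat \<Rightarrow> (real \<Rightarrow> real vec) \<Rightarrow> real \<Rightarrow> real vec \<Rightarrow> real vec" where
  "hbar n \<theta> h x v =
     d_Omega_vec h x \<odot>\<^sub>v mono2 (vec_first v (n * \<theta>)) + h x \<odot>\<^sub>v (C_mat n \<theta> *\<^sub>v mono2 v)"

definition symmetric_mat :: "nat \<Rightarrow> real mat \<Rightarrow> bool" where
  "symmetric_mat N A \<longleftrightarrow> A \<in> carrier_mat N N \<and> transpose_mat A = A"

definition psd :: "nat \<Rightarrow> real mat \<Rightarrow> bool" where
  "psd N A \<longleftrightarrow> symmetric_mat N A \<and> (\<forall>v\<in>carrier_vec N. 0 \<le> v \<bullet> (A *\<^sub>v v))"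

definition is_H_mat :: "nat \<Rightarrow> nat \<Rightarrow> (real \<Rightarrow> real vec) \<Rightarrow> real \<Rightarrow> real mat \<Rightarrow> bool" where
  "is_H_mat n \<theta> h x H \<longleftrightarrow>
     symmetric_mat (n * (\<theta> + 1)) H \<and>
     (\<forall>v\<in>carrier_vec (n * (\<theta> + 1)).
        (\<Sum>i<n_mono (n * \<theta>). hbar n \<theta> h x v $ i) = v \<bullet> (H *\<^sub>v v))"

(* Existence and uniqueness for n, \<theta> >= 1 and h x of the right length: lemma H_mat_ex1 below. *)
definition H_mat :: "nat \<Rightarrow> nat \<Rightarrow> (real \<Rightarrow> real vec) \<Rightarrow> real \<Rightarrow> real mat" where
  "H_mat n \<theta> h x = (THE H. is_H_mat n \<theta> h x H)"


lemma pairs_distinct: "distinct (pairs N)"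
proof -
  have eq: "pairs N = filter (\<lambda>(a, b). a \<le> b) (List.product [0..<N] [0..<N])"
  proof -
    have "map (Pair a) [a..<N] = filter (\<lambda>(a, b). a \<le> b) (map (Pair a) [0..<N])" if "a < N" for a
    proof -
      have "filter (\<lambda>b. a \<le> b) [0..<N] = filter (\<lambda>b. a \<le> b) [0..<a] @ filter (\<lambda>b. a \<le> b) [a..<N]"
        using upt_add_eq_append[of 0 a "N - a"] that by simp
      also have "\<dots> = [a..<N]"
        by simp
      finally show ?thesis
        by (simp add: filter_map o_def)
    qed
    then have "concat (map (\<lambda>a. map (Pair a) [a..<N]) xs)
        = filter (\<lambda>(a, b). a \<le> b) (List.product xs [0..<N])" if "set xs \<subseteq> {..<N}" for xs
      using that by (induction xs) auto
    from this[of "[0..<N]"] show ?thesis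
      unfolding pairs_def by (simp add: atLeast0LessThan)
  qed
  show ?thesis
    unfolding eq by (intro distinct_filter distinct_product) auto
qed

lemma set_pairs: "set (pairs N) = {(a, b). a \<le> b \<and> b < N}"
  unfolding pairs_def by force

lemma dim_mono2 [simp]: "dim_vec (mono2 w) = n_mono (dim_vec w)"
  unfolding mono2_def n_mono_def by simp

lemma index_mono2:
  "k < n_mono (dim_vec w) \<Longrightarrow>
   mono2 w $ k = w $ fst (pairs (dim_vec w) ! k) * w $ snd (pairs (dim_vec w) ! k)"
  unfolding mono2_def n_mono_def by (simp add: vec_of_list_index case_prod_beta)

lemma pairs_nth:
  assumes "k < n_mono N"
  shows "fst (pairs N ! k) \<le> snd (pairs N ! k)" "snd (pairs N ! k) < N" "fst (pairs N ! k) < N"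
proof -
  have "pairs N ! k \<in> set (pairs N)"
    using assms unfolding n_mono_def by simp
  then show "fst (pairs N ! k) \<le> snd (pairs N ! k)" "snd (pairs N ! k) < N" "fst (pairs N ! k) < N"
    unfolding set_pairs by auto
qed

lemma sum_pairs:
  fixes f :: "nat \<times> nat \<Rightarrow> real"
  shows "(\<Sum>k<n_mono N. f (pairs N ! k)) = (\<Sum>p\<in>set (pairs N). f p)"
proof -
  have "(\<Sum>p\<in>set (pairs N). f p) = sum_list (map f (pairs N))"
    by (simp add: pairs_distinct sum_list_distinct_conv_sum_set)
  also have "\<dots> = (\<Sum>k<n_mono N. f (pairs N ! k))"
    by (simp add: sum_list_sum_nth n_mono_def atLeast0LessThan)
  finally show ?thesis ..
qed

lemma mono2_pick:
  assumes "a < dim_vec w" "b < dim_vec w"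
  shows "(\<Sum>k<n_mono (dim_vec w). (if pairs (dim_vec w) ! k = (min a b, max a b) then 1 else 0) * mono2 w $ k)
    = w $ a * w $ b"
proof -
  let ?N = "dim_vec w" and ?f = "\<lambda>p. (if p = (min a b, max a b) then 1 else 0) * (w $ fst p * w $ snd p)"
  have "(\<Sum>k<n_mono ?N. (if pairs ?N ! k = (min a b, max a b) then 1 else 0) * mono2 w $ k)
     = (\<Sum>k<n_mono ?N. ?f (pairs ?N ! k))"
    by (intro sum.cong) (auto simp: index_mono2)
  also have "\<dots> = (\<Sum>p\<in>set (pairs ?N). ?f p)"
    by (rule sum_pairs)
  also have "\<dots> = (\<Sum>p\<in>set (pairs ?N). if p = (min a b, max a b) then w $ fst p * w $ snd p else 0)"
    by (intro sum.cong) auto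
  also have "\<dots> = w $ min a b * w $ max a b"
    using assms by (simp add: sum.delta) (auto simp: set_pairs)
  also have "\<dots> = w $ a * w $ b"
    by (simp add: min_def max_def)
  finally show ?thesis .
qed

lemma mono2_independent:
  assumes zero: "\<And>w. w \<in> carrier_vec N \<Longrightarrow> (\<Sum>k<n_mono N. d k * mono2 w $ k) = 0"
    and k: "k < n_mono N"
  shows "d k = (0::real)"
proof -
  define c where "c p = (\<Sum>k<n_mono N. if pairs N ! k = p then d k else 0)" for p
  have c: "c (pairs N ! k) = d k" if "k < n_mono N" for k
  proof -
    have "c (pairs N ! k) = (\<Sum>j<n_mono N. if j = k then d j else 0)"
      unfolding c_def using that pairs_distinct[of N]
      by (intro sum.cong) (auto simp: n_mono_def nth_eq_iff_index_eq)
    then show ?thesis using that by simp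
  qed
  have Z: "(\<Sum>p\<in>set (pairs N). c p * (w (fst p) * w (snd p))) = 0" for w :: "nat \<Rightarrow> real"
  proof -
    have "(\<Sum>p\<in>set (pairs N). c p * (w (fst p) * w (snd p)))
      = (\<Sum>k<n_mono N. c (pairs N ! k) * (w (fst (pairs N ! k)) * w (snd (pairs N ! k))))"
      by (rule sum_pairs[symmetric])
    also have "\<dots> = (\<Sum>k<n_mono N. d k * mono2 (vec N w) $ k)"
      using pairs_nth by (intro sum.cong) (auto simp: index_mono2 c)
    also have "\<dots> = 0" by (rule zero) simp
    finally show ?thesis .
  qed
  have fin: "finite (set (pairs N))" by simp
  have diag: "c (a, a) = 0" if "a < N" for a
  proof -
    have "(\<Sum>p\<in>set (pairs N). c p * (of_bool (fst p = a) * of_bool (snd p = a)))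
      = (\<Sum>p\<in>{(a, a)}. c p * (of_bool (fst p = a) * of_bool (snd p = a)))"
      using that by (intro sum.mono_neutral_right[OF fin]) (auto simp: set_pairs)
    with Z[of "\<lambda>i. of_bool (i = a)"] show ?thesis by simp
  qed
  have off: "c (a, b) = 0" if "a < b" "b < N" for a b
  proof -
    let ?w = "\<lambda>i. of_bool (i = a \<or> i = b) :: real"
    have "(\<Sum>p\<in>set (pairs N). c p * (?w (fst p) * ?w (snd p)))
      = (\<Sum>p\<in>{(a, a), (a, b), (b, b)}. c p * (?w (fst p) * ?w (snd p)))"
      using that by (intro sum.mono_neutral_right[OF fin]) (auto simp: set_pairs)
    also have "\<dots> = c (a, a) + c (a, b) + c (b, b)"
      using that by simp
    finally show ?thesis using Z[of ?w] diag[of a] diag[of b] that by simp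
  qed
  have "c (pairs N ! k) = 0"
    using pairs_nth[OF k] diag[of "fst (pairs N ! k)"] off[of "fst (pairs N ! k)" "snd (pairs N ! k)"]
    by (metis le_neq_implies_less prod.collapse)
  then show ?thesis using c[OF k] by simp
qed

lemma dim_jet [simp]: "dim_vec (jet n s u x) = n * (s + 1)"
  unfolding jet_def by simp

lemma jet_deriv:
  assumes u: "u \<in> C_fun \<theta> n" and n: "n \<ge> 1" and \<theta>: "\<theta> \<ge> 1" and a: "a < n * \<theta>" and x: "x \<in> \<Omega>"
  shows "((\<lambda>y. jet n (\<theta> - 1) u y $ a) has_vector_derivative jet n \<theta> u x $ (a + n)) (at x within \<Omega>)"
proof -
  have j: "a mod n < n" and i: "a div n < \<theta>"
    using n a by (auto simp: less_mult_imp_div_less mult.commute)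
  define f where "f = (\<partial>\<^sub>x ^^ (a div n)) (\<lambda>y. u y $ (a mod n))"
  have "f differentiable (at x within \<Omega>)"
    using u i j x unfolding f_def C_fun_def differentiable_on_def by blast
  then have "(f has_vector_derivative \<partial>\<^sub>x f x) (at x within \<Omega>)"
    unfolding d_Omega_def by (simp add: vector_derivative_works)
  moreover have "jet n (\<theta> - 1) u y $ a = f y" for y
    using a \<theta> unfolding jet_def f_def by simp
  moreover have "jet n \<theta> u x $ (a + n) = \<partial>\<^sub>x f x"
    using a n unfolding jet_def f_def by (simp add: div_add_self2)
  ultimately show ?thesis by simp
qed

lemma d_Omega_eqI:
  "(f has_vector_derivative f') (at x within \<Omega>) \<Longrightarrow> x \<in> \<Omega> \<Longrightarrow> \<partial>\<^sub>x f x = f'"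
  unfolding d_Omega_def by (rule vector_derivative_within_closed_interval) auto

lemma jet_prefix:
  "k < n * \<theta> \<Longrightarrow> \<theta> \<ge> 1 \<Longrightarrow> jet n (\<theta> - 1) u x $ k = jet n \<theta> u x $ k"
  unfolding jet_def by simp

lemma C_mat_exists:
  assumes n: "n \<ge> 1" and \<theta>: "\<theta> \<ge> 1"
  shows "\<exists>C. is_C_mat n \<theta> C"
proof -
  let ?N = "n * \<theta>" and ?M = "n * (\<theta> + 1)"
  define e where "e a b k = (if pairs ?M ! k = (min a b, max a b) then 1 else 0 :: real)" for a b k
  define C where "C = mat (n_mono ?N) (n_mono ?M)
    (\<lambda>(i, k). let a = fst (pairs ?N ! i); b = snd (pairs ?N ! i) in e (a + n) b k + e a (b + n) k)"
  have "d_Omega_vec (\<lambda>y. mono2 (jet n (\<theta> - 1) u y)) x = C *\<^sub>v mono2 (jet n \<theta> u x)"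
    if u: "u \<in> C_fun \<theta> n" and x: "x \<in> \<Omega>" for u x
  proof (rule eq_vecI)
    show "dim_vec (d_Omega_vec (\<lambda>y. mono2 (jet n (\<theta> - 1) u y)) x) = dim_vec (C *\<^sub>v mono2 (jet n \<theta> u x))"
      using \<theta> by (simp add: d_Omega_vec_def C_def)
  next
    fix i assume "i < dim_vec (C *\<^sub>v mono2 (jet n \<theta> u x))"
    then have i: "i < n_mono ?N" by (simp add: C_def)
    define a where "a = fst (pairs ?N ! i)"
    define b where "b = snd (pairs ?N ! i)"
    have ab: "a < ?N" "b < ?N" using pairs_nth[OF i] by (auto simp: a_def b_def)
    let ?w = "jet n \<theta> u x"
    have nN: "n * (\<theta> - 1 + 1) = ?N" using \<theta> by simp
    have "((\<lambda>y. jet n (\<theta> - 1) u y $ a * jet n (\<theta> - 1) u y $ b) has_vector_derivative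
       jet n (\<theta> - 1) u x $ a * ?w $ (b + n) + ?w $ (a + n) * jet n (\<theta> - 1) u x $ b) (at x within \<Omega>)"
      using jet_deriv[OF u n \<theta> ab(1) x] jet_deriv[OF u n \<theta> ab(2) x]
      by (rule has_vector_derivative_mult)
    moreover have "mono2 (jet n (\<theta> - 1) u y) $ i = jet n (\<theta> - 1) u y $ a * jet n (\<theta> - 1) u y $ b" for y
      using i nN by (simp add: index_mono2 a_def b_def)
    ultimately have lhs: "d_Omega_vec (\<lambda>y. mono2 (jet n (\<theta> - 1) u y)) x $ i
      = ?w $ a * ?w $ (b + n) + ?w $ (a + n) * ?w $ b"
      using i nN x ab \<theta> by (simp add: d_Omega_vec_def d_Omega_eqI jet_prefix del: One_nat_def)
    have "(C *\<^sub>v mono2 ?w) $ i = (\<Sum>k<n_mono ?M. (e (a + n) b k + e a (b + n) k) * mono2 ?w $ k)"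
      using i by (simp add: C_def scalar_prod_def a_def b_def Let_def atLeast0LessThan)
    also have "\<dots> = (\<Sum>k<n_mono ?M. e (a + n) b k * mono2 ?w $ k) + (\<Sum>k<n_mono ?M. e a (b + n) k * mono2 ?w $ k)"
      by (simp add: distrib_right sum.distrib)
    also have "\<dots> = ?w $ (a + n) * ?w $ b + ?w $ a * ?w $ (b + n)"
      using mono2_pick[of "a + n" ?w b] mono2_pick[of a ?w "b + n"] ab
      unfolding e_def by simp
    finally show "d_Omega_vec (\<lambda>y. mono2 (jet n (\<theta> - 1) u y)) x $ i = (C *\<^sub>v mono2 ?w) $ i"
      using lhs by simp
  qed
  then show ?thesis
    unfolding is_C_mat_def by (intro exI[of _ C]) (simp add: C_def)
qed

lemma d_Omega_cong:
  assumes "\<And>y. y \<in> \<Omega> \<Longrightarrow> f y = g y" "x \<in> \<Omega>"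
  shows "\<partial>\<^sub>x f x = \<partial>\<^sub>x g x"
proof -
  have "(f has_vector_derivative D) (at x within \<Omega>) \<longleftrightarrow> (g has_vector_derivative D) (at x within \<Omega>)" for D
    using assms by (intro has_vector_derivative_cong_ev) (auto intro: eventually_at_filter[THEN iffD2] always_eventually)
  then show ?thesis
    unfolding d_Omega_def vector_derivative_def by simp
qed

lemma iter_d_Omega_poly:
  assumes "x \<in> \<Omega>"
  shows "(\<partial>\<^sub>x ^^ i) (poly p) x = poly ((pderiv ^^ i) p) x"
  using assms
proof (induction i arbitrary: x)
  case (Suc i)
  have "(\<partial>\<^sub>x ^^ Suc i) (poly p) x = \<partial>\<^sub>x (poly ((pderiv ^^ i) p)) x"
    using d_Omega_cong[OF Suc.IH Suc.prems] by simp
  also have "\<dots> = poly ((pderiv ^^ Suc i) p) x"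
  proof (rule d_Omega_eqI[OF _ Suc.prems])
    show "(poly ((pderiv ^^ i) p) has_vector_derivative poly ((pderiv ^^ Suc i) p) x) (at x within \<Omega>)"
      using has_field_derivative_at_within[OF poly_DERIV[of "(pderiv ^^ i) p" x], of \<Omega>]
      unfolding has_real_derivative_iff_has_vector_derivative by simp
  qed
  finally show ?case .
qed simp

lemma poly_in_C_fun:
  "(\<lambda>x. vec n (\<lambda>j. poly (p j) x)) \<in> C_fun k n"
proof -
  have "(\<partial>\<^sub>x ^^ i) (\<lambda>y. vec n (\<lambda>j. poly (p j) y) $ j) differentiable_on \<Omega> \<and>
        continuous_on \<Omega> ((\<partial>\<^sub>x ^^ i) (\<lambda>y. vec n (\<lambda>j. poly (p j) y) $ j))" if "j < n" for i j
  proof -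
    have eq: "(\<partial>\<^sub>x ^^ i) (\<lambda>y. vec n (\<lambda>j. poly (p j) y) $ j) x = poly ((pderiv ^^ i) (p j)) x"
      if "x \<in> \<Omega>" for x
      using iter_d_Omega_poly[OF that] \<open>j < n\<close> by simp
    have d: "poly ((pderiv ^^ i) (p j)) differentiable_on \<Omega>"
      by (simp add: differentiable_on_def poly_differentiable differentiable_at_withinI)
    have "(\<partial>\<^sub>x ^^ i) (\<lambda>y. vec n (\<lambda>j. poly (p j) y) $ j) differentiable_on \<Omega>"
      unfolding differentiable_on_def
    proof
      fix x assume x: "x \<in> \<Omega>"
      show "(\<partial>\<^sub>x ^^ i) (\<lambda>y. vec n (\<lambda>j. poly (p j) y) $ j) differentiable (at x within \<Omega>)"
        by (rule differentiable_transform_within[where d = 1,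
              OF d[unfolded differentiable_on_def, rule_format, OF x] _ x]) (auto simp only: eq zero_less_one)
    qed
    then show ?thesis
      by (simp add: differentiable_imp_continuous_on)
  qed
  then show ?thesis
    unfolding C_fun_def by simp
qed

lemma coeff_iter_pderiv:
  "poly ((pderiv ^^ i) p) 0 = fact i * coeff p i" for p :: "real poly"
proof -
  have "coeff ((pderiv ^^ i) p) k = pochhammer (of_nat (Suc k)) i * coeff p (k + i)" for k
  proof (induction i arbitrary: k)
    case (Suc i)
    then show ?case
      by (simp add: coeff_pderiv pochhammer_rec algebra_simps)
  qed simp
  from this[of 0] show ?thesis
    by (simp add: poly_0_coeff_0 pochhammer_fact)
qed

lemma jet_arbitrary:
  assumes n: "n \<ge> 1" and w: "w \<in> carrier_vec (n * (\<theta> + 1))"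
  shows "\<exists>u\<in>C_fun \<theta> n. jet n \<theta> u 0 = w"
proof -
  define p where "p j = Poly (map (\<lambda>i. w $ (i * n + j) / fact i) [0..<\<theta> + 1])" for j
  define u where "u x = vec n (\<lambda>j. poly (p j) x)" for x
  have "jet n \<theta> u 0 $ k = w $ k" if k: "k < n * (\<theta> + 1)" for k
  proof -
    have j: "k mod n < n" and i: "k div n < \<theta> + 1"
      using n k by (auto simp: less_mult_imp_div_less mult.commute)
    have "jet n \<theta> u 0 $ k = (\<partial>\<^sub>x ^^ (k div n)) (poly (p (k mod n))) 0"
      using k j unfolding jet_def u_def by simp
    also have "\<dots> = fact (k div n) * coeff (p (k mod n)) (k div n)"
      by (simp add: iter_d_Omega_poly coeff_iter_pderiv)
    also have "coeff (p (k mod n)) (k div n) = w $ k / fact (k div n)"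
      using i unfolding p_def by (simp add: nth_default_def del: upt_Suc)
    finally show ?thesis by simp
  qed
  then have "jet n \<theta> u 0 = w" using w by (intro eq_vecI) auto
  moreover have "u \<in> C_fun \<theta> n" unfolding u_def by (rule poly_in_C_fun)
  ultimately show ?thesis by blast
qed

lemma C_mat_unique:
  assumes n: "n \<ge> 1" and C: "is_C_mat n \<theta> C" and D: "is_C_mat n \<theta> D"
  shows "C = D"
proof (rule eq_matI)
  let ?N = "n * \<theta>" and ?M = "n * (\<theta> + 1)"
  have car: "C \<in> carrier_mat (n_mono ?N) (n_mono ?M)" "D \<in> carrier_mat (n_mono ?N) (n_mono ?M)"
    using C D unfolding is_C_mat_def by auto
  then show "dim_row C = dim_row D" "dim_col C = dim_col D" by auto
  fix i k assume "i < dim_row D" "k < dim_col D"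
  then have ik: "i < n_mono ?N" "k < n_mono ?M" using car by auto
  have "(\<Sum>k<n_mono ?M. (C $$ (i, k) - D $$ (i, k)) * mono2 w $ k) = 0" if w: "w \<in> carrier_vec ?M" for w
  proof -
    obtain u where "u \<in> C_fun \<theta> n" "jet n \<theta> u 0 = w"
      using jet_arbitrary[OF n w] by blast
    then have "C *\<^sub>v mono2 w = D *\<^sub>v mono2 w"
      using C D unfolding is_C_mat_def by (metis atLeastAtMost_iff order_refl zero_le_one)
    then have "(C *\<^sub>v mono2 w) $ i = (D *\<^sub>v mono2 w) $ i" by simp
    then show ?thesis
      using ik car w
      by (simp add: scalar_prod_def row_def atLeast0LessThan left_diff_distrib sum_subtractf)
  qed
  from mono2_independent[of ?M "\<lambda>k. C $$ (i, k) - D $$ (i, k)", OF this ik(2)]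
  show "C $$ (i, k) = D $$ (i, k)" by simp
qed

lemma C_mat_ex1: "n \<ge> 1 \<Longrightarrow> \<theta> \<ge> 1 \<Longrightarrow> \<exists>!C. is_C_mat n \<theta> C"
  using C_mat_exists C_mat_unique by blast

lemma is_C_mat_C_mat: "n \<ge> 1 \<Longrightarrow> \<theta> \<ge> 1 \<Longrightarrow> is_C_mat n \<theta> (C_mat n \<theta>)"
  unfolding C_mat_def by (rule theI'[OF C_mat_ex1])

definition qform :: "nat \<Rightarrow> (real vec \<Rightarrow> real) \<Rightarrow> bool" where
  "qform N f \<longleftrightarrow> (\<exists>c. \<forall>w\<in>carrier_vec N. f w = (\<Sum>a<N. \<Sum>b<N. c a b * (w $ a * w $ b)))"

lemma qform_monom: "a < N \<Longrightarrow> b < N \<Longrightarrow> qform N (\<lambda>w. w $ a * w $ b)"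
proof -
  assume ab: "a < N" "b < N"
  have "(\<Sum>a'<N. \<Sum>b'<N. (if a' = a \<and> b' = b then 1 else 0) * (w $ a' * w $ b')) = w $ a * w $ b" for w :: "real vec"
  proof -
    have "(\<Sum>b'<N. (if a' = a \<and> b' = b then 1 else 0) * (w $ a' * w $ b'))
      = (if a' = a then w $ a * w $ b else 0)" for a'
    proof -
      have "(\<Sum>b'<N. (if a' = a \<and> b' = b then 1 else 0) * (w $ a' * w $ b'))
         = (\<Sum>b'<N. if b' = b then (if a' = a then w $ a * w $ b else 0) else 0)"
        by (intro sum.cong) auto
      then show ?thesis using ab by simp
    qed
    then show ?thesis using ab by simp
  qed
  then show ?thesis unfolding qform_def
    by (intro exI[of _ "\<lambda>a' b'. if a' = a \<and> b' = b then 1 else 0"]) simp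
qed

lemma qform_cmult: "qform N f \<Longrightarrow> qform N (\<lambda>w. c * f w)"
proof -
  assume "qform N f"
  then obtain d where "\<forall>w\<in>carrier_vec N. f w = (\<Sum>a<N. \<Sum>b<N. d a b * (w $ a * w $ b))"
    unfolding qform_def by blast
  then show ?thesis unfolding qform_def
    by (intro exI[of _ "\<lambda>a b. c * d a b"]) (simp add: sum_distrib_left mult.assoc)
qed

lemma qform_add: "qform N f \<Longrightarrow> qform N g \<Longrightarrow> qform N (\<lambda>w. f w + g w)"
proof -
  assume "qform N f" "qform N g"
  then obtain d e where "\<forall>w\<in>carrier_vec N. f w = (\<Sum>a<N. \<Sum>b<N. d a b * (w $ a * w $ b))"
    "\<forall>w\<in>carrier_vec N. g w = (\<Sum>a<N. \<Sum>b<N. e a b * (w $ a * w $ b))"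
    unfolding qform_def by blast
  then show ?thesis unfolding qform_def
    by (intro exI[of _ "\<lambda>a b. d a b + e a b"]) (simp add: sum.distrib distrib_right)
qed

lemma qform_sum: "finite I \<Longrightarrow> (\<And>i. i \<in> I \<Longrightarrow> qform N (f i)) \<Longrightarrow> qform N (\<lambda>w. \<Sum>i\<in>I. f i w)"
proof (induction I rule: finite_induct)
  case empty
  show ?case unfolding qform_def by (intro exI[of _ "\<lambda>_ _. 0"]) simp
next
  case (insert i I)
  then show ?case by (simp add: qform_add)
qed

lemma scalar_prod_mult_mat_vec_sum:
  fixes A :: "real mat"
  assumes "A \<in> carrier_mat N N" "v \<in> carrier_vec N"
  shows "v \<bullet> (A *\<^sub>v v) = (\<Sum>a<N. \<Sum>b<N. A $$ (a, b) * (v $ a * v $ b))"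
  using assms
  by (simp add: scalar_prod_def atLeast0LessThan sum_distrib_left row_def mult.left_commute)

lemma qform_symmetric_mat:
  assumes "qform N f"
  shows "\<exists>A. symmetric_mat N A \<and> (\<forall>v\<in>carrier_vec N. f v = v \<bullet> (A *\<^sub>v v))"
proof -
  obtain c where c: "\<And>w. w \<in> carrier_vec N \<Longrightarrow> f w = (\<Sum>a<N. \<Sum>b<N. c a b * (w $ a * w $ b))"
    using assms unfolding qform_def by blast
  define A where "A = mat N N (\<lambda>(a, b). (c a b + c b a) / 2)"
  have A: "A \<in> carrier_mat N N" by (simp add: A_def)
  have "transpose_mat A = A"
    by (rule eq_matI) (auto simp: A_def add.commute)
  moreover have "f v = v \<bullet> (A *\<^sub>v v)" if v: "v \<in> carrier_vec N" for v
  proof -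
    have "(\<Sum>a<N. \<Sum>b<N. c b a * (v $ a * v $ b)) = (\<Sum>a<N. \<Sum>b<N. c a b * (v $ a * v $ b))"
      by (subst sum.swap) (simp add: mult_ac)
    then have "(\<Sum>a<N. \<Sum>b<N. (c a b + c b a) / 2 * (v $ a * v $ b)) = f v"
      using c[OF v]
      by (simp add: add_divide_distrib distrib_right sum.distrib flip: sum_divide_distrib)
    then show ?thesis
      unfolding scalar_prod_mult_mat_vec_sum[OF A v] by (simp add: A_def)
  qed
  ultimately show ?thesis using A unfolding symmetric_mat_def by blast
qed

lemma symmetric_mat_eqI:
  assumes A: "symmetric_mat N A" and B: "symmetric_mat N B"
    and eq: "\<And>v. v \<in> carrier_vec N \<Longrightarrow> v \<bullet> (A *\<^sub>v v) = v \<bullet> (B *\<^sub>v v)"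
  shows "A = B"
proof -
  have car: "A \<in> carrier_mat N N" "B \<in> carrier_mat N N"
    using A B unfolding symmetric_mat_def by auto
  define d where "d a b = A $$ (a, b) - B $$ (a, b)" for a b
  have sym: "d a b = d b a" if "a < N" "b < N" for a b
    using A B car that unfolding symmetric_mat_def d_def
    by (metis carrier_matD index_transpose_mat(1))
  have Z: "(\<Sum>a<N. \<Sum>b<N. d a b * (w a * w b)) = 0" for w :: "nat \<Rightarrow> real"
    using eq[of "vec N w"]
    by (simp add: scalar_prod_mult_mat_vec_sum[OF car(1)] scalar_prod_mult_mat_vec_sum[OF car(2)]
        d_def left_diff_distrib sum_subtractf)
  have S: "(\<Sum>a<N. \<Sum>b<N. d a b * (of_bool (a \<in> I) * of_bool (b \<in> I))) = (\<Sum>a\<in>I. \<Sum>b\<in>I. d a b)"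
    if "I \<subseteq> {..<N}" for I
  proof -
    have "(\<Sum>b<N. d a b * (of_bool (a \<in> I) * of_bool (b \<in> I))) = of_bool (a \<in> I) * (\<Sum>b\<in>I. d a b)" for a
    proof -
      have "(\<Sum>b\<in>I. d a b) = (\<Sum>b<N. d a b * of_bool (b \<in> I))"
        using that by (intro sum.mono_neutral_cong_left) auto
      then show ?thesis by (simp add: sum_distrib_left mult_ac)
    qed
    then show ?thesis
      using that by (simp add: Int_absorb1)
  qed
  have diag: "d a a = 0" if "a < N" for a
    using S[of "{a}"] Z[of "\<lambda>i. of_bool (i \<in> {a})"] that by simp
  have "d a b = 0" if "a < N" "b < N" for a b
  proof (cases "a = b")
    case False
    then have "d a b + d b a = 0"
      using S[of "{a, b}"] Z[of "\<lambda>i. of_bool (i \<in> {a, b})"] that diag[of a] diag[of b] by simp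
    then show ?thesis using sym[OF that] by simp
  qed (use that diag in simp)
  then show ?thesis
    using car by (intro eq_matI) (auto simp: d_def)
qed

lemma H_mat_ex1:
  assumes n: "n \<ge> 1" and \<theta>: "\<theta> \<ge> 1" and h: "h x \<in> carrier_vec (n_mono (n * \<theta>))"
  shows "\<exists>!H. is_H_mat n \<theta> h x H"
proof -
  let ?N = "n * \<theta>" and ?M = "n * (\<theta> + 1)"
  have C: "C_mat n \<theta> \<in> carrier_mat (n_mono ?N) (n_mono ?M)"
    using is_C_mat_C_mat[OF n \<theta>] unfolding is_C_mat_def by blast
  let ?f = "\<lambda>v. \<Sum>i<n_mono ?N. d_Omega_vec h x $ i * (v $ fst (pairs ?N ! i) * v $ snd (pairs ?N ! i))
      + h x $ i * (\<Sum>k<n_mono ?M. C_mat n \<theta> $$ (i, k) * (v $ fst (pairs ?M ! k) * v $ snd (pairs ?M ! k)))"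
  have f: "qform ?M ?f"
  proof (intro qform_sum qform_add qform_cmult qform_monom)
    show "fst (pairs ?N ! i) < ?M" "snd (pairs ?N ! i) < ?M" if "i \<in> {..<n_mono ?N}" for i
      using pairs_nth[of i ?N] that by auto
    show "fst (pairs ?M ! k) < ?M" "snd (pairs ?M ! k) < ?M" if "k \<in> {..<n_mono ?M}" for k
      using pairs_nth[of k ?M] that by auto
  qed simp_all
  have eq: "(\<Sum>i<n_mono ?N. hbar n \<theta> h x v $ i) = ?f v" if v: "v \<in> carrier_vec ?M" for v
  proof (intro sum.cong refl)
    fix i assume "i \<in> {..<n_mono ?N}"
    then have i: "i < n_mono ?N" by simp
    have "(C_mat n \<theta> *\<^sub>v mono2 v) $ i
      = (\<Sum>k<n_mono ?M. C_mat n \<theta> $$ (i, k) * (v $ fst (pairs ?M ! k) * v $ snd (pairs ?M ! k)))"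
      using C v i by (simp add: scalar_prod_def row_def atLeast0LessThan index_mono2)
    moreover have "mono2 (vec_first v ?N) $ i = v $ fst (pairs ?N ! i) * v $ snd (pairs ?N ! i)"
      using i pairs_nth[OF i] by (simp add: index_mono2) (simp add: vec_first_def)
    ultimately show "hbar n \<theta> h x v $ i = d_Omega_vec h x $ i * (v $ fst (pairs ?N ! i) * v $ snd (pairs ?N ! i))
      + h x $ i * (\<Sum>k<n_mono ?M. C_mat n \<theta> $$ (i, k) * (v $ fst (pairs ?M ! k) * v $ snd (pairs ?M ! k)))"
      using i h C by (simp add: hbar_def hadamard_def d_Omega_vec_def)
  qed
  show ?thesis
  proof (rule ex_ex1I)
    show "\<exists>H. is_H_mat n \<theta> h x H"
      using qform_symmetric_mat[OF f] eq unfolding is_H_mat_def by simp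
    show "H = H'" if "is_H_mat n \<theta> h x H" "is_H_mat n \<theta> h x H'" for H H'
      using that unfolding is_H_mat_def by (auto intro!: symmetric_mat_eqI)
  qed
qed

lemma is_H_mat_H_mat:
  "n \<ge> 1 \<Longrightarrow> \<theta> \<ge> 1 \<Longrightarrow> h x \<in> carrier_vec (n_mono (n * \<theta>)) \<Longrightarrow> is_H_mat n \<theta> h x (H_mat n \<theta> h x)"
  unfolding H_mat_def by (rule theI'[OF H_mat_ex1])

lemma jet_continuous:
  assumes u: "u \<in> C_fun \<theta> n" and n: "n \<ge> 1" and k: "k < n * (\<theta> + 1)"
  shows "continuous_on \<Omega> (\<lambda>x. jet n \<theta> u x $ k)"
proof -
  have "k mod n < n" "k div n < \<theta> + 1"
    using n k by (auto simp: less_mult_imp_div_less mult.commute)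
  then have "continuous_on \<Omega> ((\<partial>\<^sub>x ^^ (k div n)) (\<lambda>y. u y $ (k mod n)))"
    using u unfolding C_fun_def by simp
  then show ?thesis using k unfolding jet_def by simp
qed

lemma integrand_integrable:
  assumes u: "u \<in> C_fun \<theta> n" and n: "n \<ge> 1"
    and F: "\<forall>x\<in>\<Omega>. symmetric_mat (n * (\<theta> + 1)) (F x)"
    and cont: "\<forall>i<n * (\<theta> + 1). \<forall>j<n * (\<theta> + 1). continuous_on \<Omega> (\<lambda>x. F x $$ (i, j))"
  shows "(\<lambda>x. jet n \<theta> u x \<bullet> (F x *\<^sub>v jet n \<theta> u x)) integrable_on \<Omega>"
proof -
  let ?M = "n * (\<theta> + 1)" and ?v = "jet n \<theta> u"
  let ?g = "\<lambda>x. \<Sum>a<?M. \<Sum>b<?M. F x $$ (a, b) * (?v x $ a * ?v x $ b)"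
  have "continuous_on \<Omega> ?g"
  proof (intro continuous_on_sum continuous_on_mult)
    fix a b assume "a \<in> {..<?M}" "b \<in> {..<?M}"
    then have ab: "a < ?M" "b < ?M" by (simp_all only: lessThan_iff)
    show "continuous_on \<Omega> (\<lambda>x. F x $$ (a, b))"
      using cont ab by blast
    show "continuous_on \<Omega> (\<lambda>x. ?v x $ a)" "continuous_on \<Omega> (\<lambda>x. ?v x $ b)"
      using jet_continuous[OF u n ab(1)] jet_continuous[OF u n ab(2)] by blast+
  qed
  then have "?g integrable_on \<Omega>"
    by (rule integrable_continuous_interval)
  moreover have "?g x = ?v x \<bullet> (F x *\<^sub>v ?v x)" if "x \<in> \<Omega>" for x
  proof (rule scalar_prod_mult_mat_vec_sum[symmetric])
    show "F x \<in> carrier_mat ?M ?M"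
      using F that unfolding symmetric_mat_def by blast
    show "?v x \<in> carrier_vec ?M"
      by (rule carrier_vecI) (rule dim_jet)
  qed
  ultimately show ?thesis
    by (rule integrable_eq)
qed

end

theory Submission
  imports Defs
begin

text \<open>
  Write \<open>v\<close> for the jet \<open>v\<^sub>\<theta>(u)\<close> and \<open>m\<close> for the vector of quadratic monomials in
  \<open>v\<^sub>\<theta>\<^sub>-\<^sub>1(u)\<close>. The form \<open>v \<bullet> H(x) v\<close> is a total derivative along the jet of \<open>u\<close>:
  by the product rule and the defining property of \<open>C\<close>, the entry \<open>i\<close> of
  \<open>hbar\<close> is the derivative of \<open>h\<^sub>i m\<^sub>i\<close>. The fundamental theorem of calculus therefore turns
  \<open>\<integral> v \<bullet> H v\<close> into the boundary term \<open>\<Sum>\<^sub>i (h\<^sub>i m\<^sub>i)(1) - (h\<^sub>i m\<^sub>i)(0)\<close>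
  (\<open>H_form_has_integral\<close>), and this is nonpositive by the definition of \<open>H_set\<close>. Since
  \<open>v \<bullet> F v + v \<bullet> H v \<ge> 0\<close> pointwise, \<open>\<integral> v \<bullet> F v \<ge> - \<integral> v \<bullet> H v \<ge> 0\<close>.
\<close>

lemma vec_first_jet:
  assumes "\<theta> \<ge> 1"
  shows "vec_first (jet n \<theta> u x) (n * \<theta>) = jet n (\<theta> - 1) u x"
proof (rule eq_vecI)
  fix i assume "i < dim_vec (jet n (\<theta> - 1) u x)"
  then have "i < n * \<theta>"
    using assms by simp
  then show "vec_first (jet n \<theta> u x) (n * \<theta>) $ i = jet n (\<theta> - 1) u x $ i"
    using jet_prefix[of i n \<theta> u x] assms by (simp add: vec_first_def)
qed (use assms in simp)

text \<open>
  The equation that characterises \<open>C_mat\<close> is between values of \<open>\<partial>\<^sub>x\<close>, which by itself says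
  nothing about differentiability; that comes from the jet entries being differentiable below
  order \<open>\<theta>\<close>.
\<close>

lemma mono2_jet_has_vector_derivative:
  assumes u: "u \<in> C_fun \<theta> n" and n: "n \<ge> 1" and \<theta>: "\<theta> \<ge> 1"
    and i: "i < n_mono (n * \<theta>)" and x: "x \<in> \<Omega>"
  shows "((\<lambda>y. mono2 (jet n (\<theta> - 1) u y) $ i) has_vector_derivative
           (C_mat n \<theta> *\<^sub>v mono2 (jet n \<theta> u x)) $ i) (at x within \<Omega>)"
proof -
  define a where "a = fst (pairs (n * \<theta>) ! i)"
  define b where "b = snd (pairs (n * \<theta>) ! i)"
  have ab: "a < n * \<theta>" "b < n * \<theta>"
    using pairs_nth[OF i] by (auto simp: a_def b_def)
  have dim: "n * (\<theta> - 1 + 1) = n * \<theta>"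
    using \<theta> by simp
  have "mono2 (jet n (\<theta> - 1) u y) $ i = jet n (\<theta> - 1) u y $ a * jet n (\<theta> - 1) u y $ b" for y
    using i dim by (simp add: index_mono2 a_def b_def)
  then have "(\<lambda>y. mono2 (jet n (\<theta> - 1) u y) $ i)
      = (\<lambda>y. jet n (\<theta> - 1) u y $ a * jet n (\<theta> - 1) u y $ b)"
    by (rule ext)
  then obtain D where D: "((\<lambda>y. mono2 (jet n (\<theta> - 1) u y) $ i) has_vector_derivative D) (at x within \<Omega>)"
    using has_vector_derivative_mult[OF jet_deriv[OF u n \<theta> ab(1) x] jet_deriv[OF u n \<theta> ab(2) x]]
    by metis
  have "d_Omega_vec (\<lambda>y. mono2 (jet n (\<theta> - 1) u y)) x = C_mat n \<theta> *\<^sub>v mono2 (jet n \<theta> u x)"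
    using is_C_mat_C_mat[OF n \<theta>] u x unfolding is_C_mat_def by blast
  moreover have "d_Omega_vec (\<lambda>y. mono2 (jet n (\<theta> - 1) u y)) x $ i = D"
    using i dim d_Omega_eqI[OF D x] by (simp add: d_Omega_vec_def)
  ultimately show ?thesis
    using D by simp
qed

text \<open>
  With \<open>v\<close> specialised to the jet of \<open>u\<close>, the two summands of \<open>hbar\<close> are the two terms of the
  product rule.
\<close>

lemma hbar_is_derivative:
  assumes u: "u \<in> C_fun \<theta> n" and h: "h \<in> C_fun 1 (n_mono (n * \<theta>))"
    and n: "n \<ge> 1" and \<theta>: "\<theta> \<ge> 1"
    and i: "i < n_mono (n * \<theta>)" and x: "x \<in> \<Omega>"
  shows "((\<lambda>y. h y $ i * mono2 (jet n (\<theta> - 1) u y) $ i) has_vector_derivative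
           hbar n \<theta> h x (jet n \<theta> u x) $ i) (at x within \<Omega>)"
proof -
  have hx: "h x \<in> carrier_vec (n_mono (n * \<theta>))"
    using h x unfolding C_fun_def by blast
  have "((\<partial>\<^sub>x ^^ 0) (\<lambda>y. h y $ i)) differentiable_on \<Omega>"
    using h i unfolding C_fun_def by blast
  then have "((\<lambda>y. h y $ i) has_vector_derivative \<partial>\<^sub>x (\<lambda>y. h y $ i) x) (at x within \<Omega>)"
    using x unfolding d_Omega_def differentiable_on_def by (simp add: vector_derivative_works)
  note has_vector_derivative_mult[OF this mono2_jet_has_vector_derivative[OF u n \<theta> i x]]
  moreover have "dim_row (C_mat n \<theta>) = n_mono (n * \<theta>)"
    using is_C_mat_C_mat[OF n \<theta>] unfolding is_C_mat_def by auto
  then have "hbar n \<theta> h x (jet n \<theta> u x) $ i =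
      h x $ i * (C_mat n \<theta> *\<^sub>v mono2 (jet n \<theta> u x)) $ i
      + \<partial>\<^sub>x (\<lambda>y. h y $ i) x * mono2 (jet n (\<theta> - 1) u x) $ i"
    using i hx \<theta> unfolding hbar_def vec_first_jet[OF \<theta>]
    by (simp add: hadamard_def d_Omega_vec_def)
  ultimately show ?thesis
    by simp
qed

text \<open>
  The integrand is the derivative of \<open>\<Sum>\<^sub>i h\<^sub>i m\<^sub>i\<close>, so the fundamental theorem of calculus
  gives both its integrability and the value of its integral.
\<close>

lemma H_form_has_integral:
  assumes u: "u \<in> C_fun \<theta> n" and h: "h \<in> C_fun 1 (n_mono (n * \<theta>))"
    and n: "n \<ge> 1" and \<theta>: "\<theta> \<ge> 1"
  shows "((\<lambda>x. jet n \<theta> u x \<bullet> (H_mat n \<theta> h x *\<^sub>v jet n \<theta> u x)) has_integral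
           (\<Sum>i<n_mono (n * \<theta>). h 1 $ i * mono2 (jet n (\<theta> - 1) u 1) $ i
                              - h 0 $ i * mono2 (jet n (\<theta> - 1) u 0) $ i)) \<Omega>"
proof -
  have sum_int: "((\<lambda>x. \<Sum>i<n_mono (n * \<theta>). hbar n \<theta> h x (jet n \<theta> u x) $ i) has_integral
           (\<Sum>i<n_mono (n * \<theta>). h 1 $ i * mono2 (jet n (\<theta> - 1) u 1) $ i
                              - h 0 $ i * mono2 (jet n (\<theta> - 1) u 0) $ i)) \<Omega>"
  proof (rule has_integral_sum)
    fix i assume "i \<in> {..<n_mono (n * \<theta>)}"
    then show "((\<lambda>x. hbar n \<theta> h x (jet n \<theta> u x) $ i) has_integral
        (h 1 $ i * mono2 (jet n (\<theta> - 1) u 1) $ i - h 0 $ i * mono2 (jet n (\<theta> - 1) u 0) $ i)) \<Omega>"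
      by (intro fundamental_theorem_of_calculus hbar_is_derivative[OF u h n \<theta>]) auto
  qed simp
  have "(\<Sum>i<n_mono (n * \<theta>). hbar n \<theta> h x (jet n \<theta> u x) $ i)
      = jet n \<theta> u x \<bullet> (H_mat n \<theta> h x *\<^sub>v jet n \<theta> u x)" if "x \<in> \<Omega>" for x
  proof -
    have "h x \<in> carrier_vec (n_mono (n * \<theta>))"
      using h that unfolding C_fun_def by blast
    from is_H_mat_H_mat[OF n \<theta>, of h x, OF this] show ?thesis
      unfolding is_H_mat_def using carrier_vecI[OF dim_jet] by blast
  qed
  from has_integral_eq[OF this sum_int] show ?thesis .
qed

text \<open>
  The inequality in \<open>H_set\<close> is elementwise, so every summand is nonpositive.
\<close>

lemma boundary_term_nonpos:
  assumes h: "h \<in> H_set n \<theta> nb B" and u: "u \<in> U_set n \<theta> nb B" and \<theta>: "\<theta> \<ge> 1"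
  shows "(\<Sum>i<n_mono (n * \<theta>). h 1 $ i * mono2 (jet n (\<theta> - 1) u 1) $ i
                              - h 0 $ i * mono2 (jet n (\<theta> - 1) u 0) $ i) \<le> 0"
proof (rule sum_nonpos)
  fix i assume "i \<in> {..<n_mono (n * \<theta>)}"
  moreover have "h 0 \<in> carrier_vec (n_mono (n * \<theta>))" "h 1 \<in> carrier_vec (n_mono (n * \<theta>))"
    using h unfolding H_set_def C_fun_def by auto
  moreover have "h 1 \<odot>\<^sub>v mono2 (jet n (\<theta> - 1) u 1) - h 0 \<odot>\<^sub>v mono2 (jet n (\<theta> - 1) u 0)
      \<le> 0\<^sub>v (n_mono (n * \<theta>))"
    using h u unfolding H_set_def by blast
  ultimately show "h 1 $ i * mono2 (jet n (\<theta> - 1) u 1) $ i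
      - h 0 $ i * mono2 (jet n (\<theta> - 1) u 0) $ i \<le> 0"
    by (auto simp: less_eq_vec_def hadamard_def)
qed

theorem proposition1:
  fixes n \<theta> nb :: nat
    and B :: "real mat"
    and F :: "real \<Rightarrow> real mat"
  assumes "n \<ge> 1" and "\<theta> \<ge> 1"
    and "B \<in> carrier_mat nb (2 * n * \<theta>)"
    and "\<forall>x\<in>\<Omega>. symmetric_mat (n * (\<theta> + 1)) (F x)"
    and "\<forall>i<n * (\<theta> + 1). \<forall>j<n * (\<theta> + 1). continuous_on \<Omega> (\<lambda>x. F x $$ (i, j))"
    and "\<exists>h\<in>H_set n \<theta> nb B. \<forall>x\<in>\<Omega>. psd (n * (\<theta> + 1)) (F x + H_mat n \<theta> h x)"
  shows "\<forall>u\<in>U_set n \<theta> nb B.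
           integral \<Omega> (\<lambda>x. fbar F x (jet n \<theta> u x))
             = integral \<Omega> (\<lambda>x. jet n \<theta> u x \<bullet> (F x *\<^sub>v jet n \<theta> u x)) \<and>
           0 \<le> integral \<Omega> (\<lambda>x. jet n \<theta> u x \<bullet> (F x *\<^sub>v jet n \<theta> u x))"
proof (intro ballI conjI)
  fix u assume u: "u \<in> U_set n \<theta> nb B"
  let ?v = "jet n \<theta> u"
  show "integral \<Omega> (\<lambda>x. fbar F x (?v x)) = integral \<Omega> (\<lambda>x. ?v x \<bullet> (F x *\<^sub>v ?v x))"
    by (simp add: fbar_def)
  have uC: "u \<in> C_fun \<theta> n"
    using u unfolding U_set_def by blast
  obtain h where h: "h \<in> H_set n \<theta> nb B"
    and T: "\<And>x. x \<in> \<Omega> \<Longrightarrow> psd (n * (\<theta> + 1)) (F x + H_mat n \<theta> h x)"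
    using assms(6) by blast
  have hC: "h \<in> C_fun 1 (n_mono (n * \<theta>))"
    using h unfolding H_set_def by blast
  note F_int = integrable_integral[OF integrand_integrable[OF uC assms(1,4,5)]]
  note H_int = H_form_has_integral[OF uC hC assms(1,2)]
  have "0 \<le> ?v x \<bullet> (F x *\<^sub>v ?v x) + ?v x \<bullet> (H_mat n \<theta> h x *\<^sub>v ?v x)" if x: "x \<in> \<Omega>" for x
  proof -
    have v: "?v x \<in> carrier_vec (n * (\<theta> + 1))"
      by (rule carrier_vecI) (rule dim_jet)
    have F: "F x \<in> carrier_mat (n * (\<theta> + 1)) (n * (\<theta> + 1))"
      using assms(4) x unfolding symmetric_mat_def by blast
    have "h x \<in> carrier_vec (n_mono (n * \<theta>))"
      using hC x unfolding C_fun_def by blast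
    from is_H_mat_H_mat[OF assms(1,2), of h x, OF this]
    have H: "H_mat n \<theta> h x \<in> carrier_mat (n * (\<theta> + 1)) (n * (\<theta> + 1))"
      unfolding is_H_mat_def symmetric_mat_def by blast
    have "0 \<le> ?v x \<bullet> ((F x + H_mat n \<theta> h x) *\<^sub>v ?v x)"
      using T[OF x] v unfolding psd_def by blast
    also have "\<dots> = ?v x \<bullet> (F x *\<^sub>v ?v x) + ?v x \<bullet> (H_mat n \<theta> h x *\<^sub>v ?v x)"
      unfolding add_mult_distrib_mat_vec[OF F H v]
      by (rule scalar_prod_add_distrib[OF v mult_mat_vec_carrier[OF F v] mult_mat_vec_carrier[OF H v]])
    finally show ?thesis .
  qed
  from has_integral_nonneg[OF has_integral_add[OF F_int H_int] this]
  show "0 \<le> integral \<Omega> (\<lambda>x. ?v x \<bullet> (F x *\<^sub>v ?v x))"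
    using boundary_term_nonpos[OF h u assms(2)] by linarith
qed

end
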